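(* Let $\mathcal{X}$ be a finite non-empty set with $|\mathcal{X}|=n$, let $p\in\Sigma_\mathcal{X}$ be a probability mass function on $\mathcal{X}$, let $\delta\in[0,1]$ and let $f\colon\mathcal{X}\to\mathbb{R}$. Order the elements of $\mathcal{X}=\{x_1,\ldots,x_n\}$ such that $f(x_1)\leq f(x_2)\leq\cdots\leq f(x_n)$. Let $r\in\{1,\ldots,n\}$ be the smallest index such that $\delta\geq\sum_{i=r+1}^{n}p(x_i)$ (where the empty sum, for $r=n$, is $0$, so such an index exists). Then \[ \underline{E}^{\mathrm{TV}}_{p,\delta}(f)=E_{q_{\mathrm{TV}}}(f), \] where, if $r>1$, $q_{\mathrm{TV}}\in\Sigma_\mathcal{X}$ is given by \[ q_{\mathrm{TV}}(x_i):=\begin{cases} p(x_1)+\delta & \text{if } i=1,\\ p(x_i) & \text{if } i\in\{2,\ldots,r-1\},\\ \sum_{j=r}^{n}p(x_j)-\delta & \text{if } i=r,\\ 0 & \text{if } i\in\{r+1,\ldots,n\},\end{cases} \] and, if $r=1$, $q_{\mathrm{TV}}\in\Sigma_\mathcal{X}$ is given by \[ q_{\mathrm{TV}}(x_i):=\begin{cases}1 & \text{if } i=1,\\ 0 & \text{if } i\in\{2,\ldots,n\}.\end{cases} \]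
   Context: $\Sigma_\mathcal{X}$ denotes the set of all probability mass functions on the finite set $\mathcal{X}$, i.e. functions $q\colon\mathcal{X}\to[0,1]$ with $\sum_{x\in\mathcal{X}}q(x)=1$. For $q\in\Sigma_\mathcal{X}$ and $f\colon\mathcal{X}\to\mathbb{R}$, $E_q(f):=\sum_{x\in\mathcal{X}}q(x)f(x)$. The total variation distance is $d_{\mathrm{TV}}(q,p):=\frac12\sum_{x\in\mathcal{X}}|q(x)-p(x)|$, the total variation ball is $B_{\mathrm{TV}}(p,\delta):=\{q\in\Sigma_\mathcal{X}: d_{\mathrm{TV}}(q,p)\leq\delta\}$, and the corresponding lower expectation is $\underline{E}^{\mathrm{TV}}_{p,\delta}(f):=\inf_{q\in B_{\mathrm{TV}}(p,\delta)}E_q(f)$. *)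

theory Defs
  imports Complex_Main "HOL-Library.FuncSet"
begin

text \<open>
  Functions on \<open>X\<close> are represented by extensional functions, so that mass functions that agree
  on \<open>X\<close> are equal.
\<close>
definition mass_functions :: "'a set \<Rightarrow> ('a \<Rightarrow> real) set" where
  "mass_functions X = {q \<in> X \<rightarrow>\<^sub>E {0..1}. (\<Sum>x\<in>X. q x) = 1}"

definition expect :: "'a set \<Rightarrow> ('a \<Rightarrow> real) \<Rightarrow> ('a \<Rightarrow> real) \<Rightarrow> real" where
  "expect X q f = (\<Sum>x\<in>X. q x * f x)"

definition tv_dist :: "'a set \<Rightarrow> ('a \<Rightarrow> real) \<Rightarrow> ('a \<Rightarrow> real) \<Rightarrow> real" where
  "tv_dist X q p = 1 / 2 * (\<Sum>x\<in>X. \<bar>q x - p x\<bar>)"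

definition tv_ball :: "'a set \<Rightarrow> ('a \<Rightarrow> real) \<Rightarrow> real \<Rightarrow> ('a \<Rightarrow> real) set" where
  "tv_ball X p \<delta> = {q \<in> mass_functions X. tv_dist X q p \<le> \<delta>}"

text \<open>
  For finite \<open>X\<close>, a mass function \<open>p\<close> and \<open>\<delta> \<ge> 0\<close>, the infimum is over a nonempty set
  of reals that is bounded below, so it is a genuine greatest lower bound.
\<close>
definition lower_expect_tv :: "'a set \<Rightarrow> ('a \<Rightarrow> real) \<Rightarrow> real \<Rightarrow> ('a \<Rightarrow> real) \<Rightarrow> real" where
  "lower_expect_tv X p \<delta> f = (INF q\<in>tv_ball X p \<delta>. expect X q f)"

text \<open>
  Here \<open>x\<close> is a bijection from \<open>{1..card X}\<close> onto \<open>X\<close>, and \<open>i\<close> is the index of \<open>y\<close>, i.e.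
  \<open>y = x i\<close>.
\<close>
definition q_tv :: "'a set \<Rightarrow> ('a \<Rightarrow> real) \<Rightarrow> real \<Rightarrow> (nat \<Rightarrow> 'a) \<Rightarrow> nat \<Rightarrow> 'a \<Rightarrow> real" where
  "q_tv X p \<delta> x r =
    (\<lambda>y\<in>X. let i = the_inv_into {1..card X} x y in
       if r > 1 then
         (if i = 1 then p (x 1) + \<delta>
          else if i \<in> {2..r - 1} then p (x i)
          else if i = r then (\<Sum>j=r..card X. p (x j)) - \<delta>
          else 0)
       else (if i = 1 then 1 else 0))"

end

theory Submission
  imports Defs
begin

text \<open>
  For mass functions \<open>q\<close> and \<open>p\<close>, the total variation distance is the total of the positive parts
  of \<open>q - p\<close>: the mass that has to be moved to turn \<open>p\<close> into \<open>q\<close>. The ball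
  of radius \<open>\<delta>\<close> thus allows a mass of at most \<open>\<delta>\<close> to be moved, and the expectation of \<open>f\<close> drops most
  if that mass is taken from where \<open>f\<close> is largest and put where \<open>f\<close> is smallest. This is what
  \<open>q_tv\<close> does: it empties the points above \<open>x r\<close>, takes the remainder of the budget from \<open>x r\<close>
  if \<open>r > 1\<close>, and piles everything onto \<open>x 1\<close>.

  That \<open>q_tv\<close> lies in the ball depends on the choice of \<open>r\<close>: the budget suffices to empty the points
  above \<open>x r\<close>, and, if \<open>r > 1\<close>, the minimality of \<open>r\<close> says that it does not suffice to empty \<open>x r\<close>
  as well. So \<open>q_tv\<close> is nonnegative and exceeds \<open>p\<close> only at \<open>x 1\<close>, by at most \<open>\<delta>\<close>.

  Optimality is a duality argument, in \<open>sum_le_if_mass_moved_down\<close>. Subtracting the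
  constant \<open>f (x r)\<close> from \<open>f\<close> does not affect comparisons between mass functions. Each point
  then has a simple lower bound for its contribution to the expectation under \<open>q\<close> minus that under \<open>q_tv\<close>; these
  bounds add up to the gap \<open>f (x r) - f (x 1)\<close> times the part of the budget that \<open>q\<close> leaves unused.
\<close>

text \<open>
  Since \<open>q - p\<close> sums to zero, its positive and negative parts have the same total; this cancels the
  factor \<open>1 / 2\<close> of the distance.
\<close>
lemma tv_dist_eq_sum_positive_part:
  assumes "(\<Sum>y\<in>X. q y) = (\<Sum>y\<in>X. p y)"
  shows "tv_dist X q p = (\<Sum>y\<in>X. max 0 (q y - p y))"
proof -
  have "(\<Sum>y\<in>X. \<bar>q y - p y\<bar>) = (\<Sum>y\<in>X. 2 * max 0 (q y - p y) - (q y - p y))"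
    by (intro sum.cong) (auto simp: max_def)
  also have "\<dots> = 2 * (\<Sum>y\<in>X. max 0 (q y - p y))"
    using assms by (simp add: sum_subtractf sum_distrib_left)
  finally show ?thesis
    by (simp add: tv_dist_def)
qed

lemma mass_functionsI:
  assumes "finite X" and "q \<in> extensional X" and "\<And>y. y \<in> X \<Longrightarrow> q y \<ge> 0"
    and "(\<Sum>y\<in>X. q y) = 1"
  shows "q \<in> mass_functions X"
proof -
  have "q y \<le> 1" if "y \<in> X" for y
    using member_le_sum[of y X q] that assms by auto
  then show ?thesis
    using assms by (auto simp: mass_functions_def PiE_def)
qed

text \<open>
  The sequence \<open>Q\<close> arises from \<open>P\<close> by adding the whole budget \<open>\<delta>\<close> at the smallest value of \<open>F\<close> and
  emptying all indices above \<open>r\<close>; its value at \<open>r\<close> is determined by the total mass. If \<open>r = 1\<close>,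
  all mass sits at index 1, and the budget need not be used up.
\<close>
lemma sum_le_if_mass_moved_down:
  fixes P Q q F :: "nat \<Rightarrow> real"
  assumes mono: "mono_on {1..n} F" and r: "r \<in> {1..n}"
    and below: "\<And>i. i \<in> {1..<r} \<Longrightarrow> Q i = P i + (if i = 1 then \<delta> else 0)"
    and above: "\<And>i. i \<in> {r<..n} \<Longrightarrow> Q i = 0"
    and nonneg: "\<And>i. i \<in> {1..n} \<Longrightarrow> q i \<ge> 0"
    and total: "(\<Sum>i=1..n. q i) = (\<Sum>i=1..n. Q i)"
    and budget: "(\<Sum>i=1..n. max 0 (q i - P i)) \<le> \<delta>"
  shows "(\<Sum>i=1..n. Q i * F i) \<le> (\<Sum>i=1..n. q i * F i)"
proof -
  have F1r: "F 1 \<le> F r"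
    using mono_onD[OF mono, of 1 r] r by simp
  \<comment> \<open>The values of \<open>F\<close> below \<open>r\<close> lie between \<open>F 1\<close> and \<open>F r\<close>, so mass added there by \<open>q\<close> gains at most
    what it would gain at index 1; the values above \<open>r\<close> can only make \<open>q\<close> worse than \<open>Q\<close>.\<close>
  have pointwise: "(max 0 (q i - P i) - (if i = 1 then \<delta> else 0)) * (F 1 - F r)
      \<le> (q i - Q i) * (F i - F r)" if i: "i \<in> {1..n}" for i
  proof (cases "i < r")
    case True
    have F: "F 1 \<le> F i" "F i \<le> F r"
      using mono_onD[OF mono, of 1 i] mono_onD[OF mono, of i r] r i True by auto
    have "max 0 (q i - P i) * (F 1 - F r) \<le> max 0 (q i - P i) * (F i - F r)"
      using F by (intro mult_left_mono) auto
    also have "\<dots> \<le> (q i - P i) * (F i - F r)"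
      using F by (intro mult_right_mono_neg) auto
    finally show ?thesis
      using below[of i] i True by (cases "i = 1") (auto simp: algebra_simps)
  next
    case False
    have "max 0 (q i - P i) * (F 1 - F r) \<le> 0"
      using F1r by (intro mult_nonneg_nonpos) auto
    then have "(max 0 (q i - P i) - (if i = 1 then \<delta> else 0)) * (F 1 - F r) \<le> 0"
      using False r by (cases "i = 1") auto
    also have "0 \<le> (q i - Q i) * (F i - F r)"
    proof (cases "i = r")
      case False
      then show ?thesis
        using \<open>\<not> i < r\<close> i r above[of i] nonneg[of i] mono_onD[OF mono, of r i]
        by auto
    qed simp
    finally show ?thesis .
  qed
  have "0 \<le> ((\<Sum>i=1..n. max 0 (q i - P i)) - \<delta>) * (F 1 - F r)"
    using budget F1r by (intro mult_nonpos_nonpos) auto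
  also have "\<dots> = (\<Sum>i=1..n. (max 0 (q i - P i) - (if i = 1 then \<delta> else 0)) * (F 1 - F r))"
    using r by (simp add: sum_distrib_right[symmetric] sum_subtractf)
  also have "\<dots> \<le> (\<Sum>i=1..n. (q i - Q i) * (F i - F r))"
    using pointwise by (rule sum_mono)
  also have "\<dots> = (\<Sum>i=1..n. q i * F i) - (\<Sum>i=1..n. Q i * F i)
      - ((\<Sum>i=1..n. q i) - (\<Sum>i=1..n. Q i)) * F r"
    by (simp add: algebra_simps sum.distrib sum_subtractf sum_distrib_left)
  finally show ?thesis
    using total by simp
qed

theorem theorem1:
  fixes X :: "'a set" and n r :: nat and p f :: "'a \<Rightarrow> real" and \<delta> :: real
    and x :: "nat \<Rightarrow> 'a"
  assumes "finite X" and "X \<noteq> {}" and "card X = n"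
    and "p \<in> mass_functions X"
    and "\<delta> \<in> {0..1}"
    and "bij_betw x {1..n} X"
    and "mono_on {1..n} (\<lambda>i. f (x i))"
    and "r = (LEAST k. k \<in> {1..n} \<and> \<delta> \<ge> (\<Sum>i=k+1..n. p (x i)))"
  shows "q_tv X p \<delta> x r \<in> mass_functions X
       \<and> lower_expect_tv X p \<delta> f = expect X (q_tv X p \<delta> x r) f"
proof -
  define Q where "Q = (\<lambda>i. q_tv X p \<delta> x r (x i))"
  have n: "n \<ge> 1"
    using assms(1-3) by (metis One_nat_def Suc_leI card_gt_0_iff)
  have sum_X: "(\<Sum>y\<in>X. g y) = (\<Sum>i=1..n. g (x i))" for g :: "'a \<Rightarrow> real"
    using sum.reindex_bij_betw[OF assms(6), of g] by simp
  have ball_X: "(\<forall>y\<in>X. R y) \<longleftrightarrow> (\<forall>i\<in>{1..n}. R (x i))" for R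
    using bij_betw_imp_surj_on[OF assms(6)] by auto
  have p_nonneg: "p (x i) \<ge> 0" if "i \<in> {1..n}" for i
    using that assms(4) bij_betw_apply[OF assms(6)] by (fastforce simp: mass_functions_def PiE_iff)
  have p_total: "(\<Sum>i=1..n. p (x i)) = 1"
    using assms(4) sum_X[of p] by (simp add: mass_functions_def)

  have "r \<in> {1..n} \<and> \<delta> \<ge> (\<Sum>i=r+1..n. p (x i))"
    unfolding assms(8) by (rule LeastI[of _ n]) (use n assms(5) in auto)
  then have r: "r \<in> {1..n}" and tail: "(\<Sum>i=r+1..n. p (x i)) \<le> \<delta>"
    by auto
  have tail_from_r: "\<delta> < (\<Sum>i=r..n. p (x i))" if "r > 1"
    using not_less_Least[of "r - 1" "\<lambda>k. k \<in> {1..n} \<and> \<delta> \<ge> (\<Sum>i=k+1..n. p (x i))"] that r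
    unfolding assms(8)[symmetric] by auto
  have split_r: "(\<Sum>i=r..n. g i) = g r + (\<Sum>i=r+1..n. g i)" for g :: "nat \<Rightarrow> real"
    using r by (simp add: sum.atLeast_Suc_atMost)
  have split_below: "(\<Sum>i=1..n. g i) = (\<Sum>i=1..<r. g i) + (\<Sum>i=r..n. g i)"
    for g :: "nat \<Rightarrow> real"
    using r by (subst sum.union_disjoint[symmetric]) (auto intro!: sum.cong)

  have Q: "Q i = (if r > 1 then
         (if i = 1 then p (x 1) + \<delta>
          else if i \<in> {2..r - 1} then p (x i)
          else if i = r then (\<Sum>j=r..n. p (x j)) - \<delta>
          else 0)
       else (if i = 1 then 1 else 0))" if "i \<in> {1..n}" for i
    using that bij_betw_apply[OF assms(6) that] assms(3)
      the_inv_into_f_f[OF bij_betw_imp_inj_on[OF assms(6)] that]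
    by (simp add: Q_def q_tv_def Let_def)
  have Q_below: "Q i = p (x i) + (if i = 1 then \<delta> else 0)" if "i \<in> {1..<r}" for i
    using that r by (auto simp: Q)
  have Q_r: "Q r = (if r > 1 then (\<Sum>j=r..n. p (x j)) - \<delta> else 1)"
    using r by (auto simp: Q)
  have Q_above: "Q i = 0" if "i \<in> {r<..n}" for i
    using that r by (auto simp: Q)

  have Q_nonneg: "Q i \<ge> 0" if "i \<in> {1..n}" for i
    using that p_nonneg[of i] assms(5) Q_below[of i] Q_r Q_above[of i] tail_from_r
    by (cases i r rule: linorder_cases) auto
  have "(\<Sum>i=1..n. Q i) = (\<Sum>i=1..<r. p (x i) + (if i = 1 then \<delta> else 0)) + Q r"
    unfolding split_below[of Q] split_r[of Q] using Q_below Q_above by simp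
  also have "\<dots> = (\<Sum>i=1..<r. p (x i)) + (if r > 1 then \<delta> else 0) + Q r"
    by (simp add: sum.distrib)
  also have "\<dots> = 1"
    using p_total r split_below[of "\<lambda>i. p (x i)"] by (simp add: Q_r)
  finally have Q_total: "(\<Sum>i=1..n. Q i) = 1" .

  have mass: "q_tv X p \<delta> x r \<in> mass_functions X"
  proof (rule mass_functionsI[OF assms(1)])
    show "q_tv X p \<delta> x r \<in> extensional X"
      by (simp add: q_tv_def)
    show "q_tv X p \<delta> x r y \<ge> 0" if "y \<in> X" for y
      using that ball_X[of "\<lambda>y. q_tv X p \<delta> x r y \<ge> 0"] Q_nonneg by (auto simp: Q_def)
    show "(\<Sum>y\<in>X. q_tv X p \<delta> x r y) = 1"
      using Q_total by (simp add: sum_X Q_def)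
  qed

  have tv: "tv_dist X q p = (\<Sum>i=1..n. max 0 (q (x i) - p (x i)))"
    if "q \<in> mass_functions X" for q
    using that assms(4) by (subst tv_dist_eq_sum_positive_part) (auto simp: sum_X mass_functions_def)

  have Q_excess: "max 0 (Q i - p (x i)) \<le> (if i = 1 then \<delta> else 0)" if i: "i \<in> {1..n}" for i
  proof (cases i r rule: linorder_cases)
    case less
    then show ?thesis
      using i assms(5) Q_below[of i] by auto
  next
    case equal
    show ?thesis
    proof (cases "r = 1")
      case True
      \<comment> \<open>Here \<open>1 - p (x 1)\<close> is the mass above \<open>x 1\<close>, which is within the budget.\<close>
      then show ?thesis
        using equal Q_r p_total split_r[of "\<lambda>i. p (x i)"] tail assms(5) by auto
    next
      case False
      then show ?thesis
        using equal r Q_r split_r[of "\<lambda>i. p (x i)"] tail by auto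
    qed
  next
    case greater
    then show ?thesis
      using i r Q_above[of i] p_nonneg[of i] by auto
  qed
  have "tv_dist X (q_tv X p \<delta> x r) p \<le> (\<Sum>i=1..n. if i = 1 then \<delta> else 0)"
    unfolding tv[OF mass] using Q_excess by (intro sum_mono) (simp add: Q_def)
  also have "\<dots> = \<delta>"
    using n by simp
  finally have in_ball: "q_tv X p \<delta> x r \<in> tv_ball X p \<delta>"
    using mass by (simp add: tv_ball_def)

  have "expect X (q_tv X p \<delta> x r) f \<le> expect X q f" if "q \<in> tv_ball X p \<delta>" for q
  proof -
    have q: "q \<in> mass_functions X" and dist: "tv_dist X q p \<le> \<delta>"
      using that by (auto simp: tv_ball_def)
    have "(\<Sum>i=1..n. Q i * f (x i)) \<le> (\<Sum>i=1..n. q (x i) * f (x i))"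
    proof (rule sum_le_if_mass_moved_down[OF assms(7) r Q_below Q_above])
      show "q (x i) \<ge> 0" if "i \<in> {1..n}" for i
        using that q bij_betw_apply[OF assms(6)] by (fastforce simp: mass_functions_def PiE_iff)
      show "(\<Sum>i=1..n. q (x i)) = (\<Sum>i=1..n. Q i)"
        using q Q_total sum_X[of q] by (simp add: mass_functions_def)
      show "(\<Sum>i=1..n. max 0 (q (x i) - p (x i))) \<le> \<delta>"
        using dist tv[OF q] by simp
    qed
    then show ?thesis
      by (simp add: expect_def sum_X Q_def)
  qed
  then have "lower_expect_tv X p \<delta> f = expect X (q_tv X p \<delta> x r) f"
    unfolding lower_expect_tv_def using in_ball by (intro cInf_eq_minimum) auto
  with mass show ?thesis
    by blast
qed

end
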